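(* Let $N\ge 1$ and let decision making units (DMUs) $1,\dots,N$ be given with nonnegative input vectors $a_1,\dots,a_N\in\mathbb{R}^{n_1}$ and nonnegative output vectors $b_1,\dots,b_N\in\mathbb{R}^{n_2}$. Let $c_k$ be the classical DEA ranking and $r_k$ the robust nonlinear ranking of unit $k$, both defined in the context. Then the list of DMUs sorted by the robust nonlinear ranking $r$ is the same as the list of DMUs sorted by the classical DEA ranking $c$; that is, for all $k,l\in\{1,\dots,N\}$, $r_k\le r_l$ if and only if $c_k\le c_l$.
   Context: For each $k\in\{1,\dots,N\}$ take unit $k$ as the tested unit $\mathrm{DMU}_0$: put $x_0=a_k$, $y_0=b_k$, and let $X$ and $Y$ be the matrices whose rows are $a_i^T$ and $b_i^T$, respectively, for $i\ne k$ (the data of the other units). Vector inequalities are entrywise. The classical DEA (CCR) ranking $c_k$ of unit $k$ is the optimal value (with value $+\infty$ if the program is unbounded) of the linear program $$\max\ y_0^Tu\quad\text{subject to}\quad x_0^Tv\le 1,\ Yu-Xv\le 0,\ u,v\ge 0$$ in the variables $u\in\mathbb{R}^{n_2}$, $v\in\mathbb{R}^{n_1}$. The robust nonlinear ranking of unit $k$ is $r_k=1+\delta^*$, where $$\delta^*=2\max\ \delta\quad\text{subject to}\quad (1-\delta)y_0^Tu\ge 1,\ \ (1+\delta)x_0^Tv\le 1,\ \ (1+\delta)Yu-(1-\delta)Xv\le 0,\ \ u,v\ge 0$$ in the variables $\delta\in\mathbb{R}$, $u\in\mathbb{R}^{n_2}$, $v\in\mathbb{R}^{n_1}$; the maximum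 is understood as a supremum if it is not attained.
   Formalization: If the robust program of unit k is infeasible (exactly when b_k = 0), its maximum of δ is taken to be −1, so r_k = −1; with the value −∞ the claim fails, e.g. for N = 3, a = (1,0,1), b = (0,1,1). *)

theory Defs
  imports "HOL-Analysis.Analysis"
begin

text \<open>
  Units are indexed by \<open>{1..N}\<close>; unit \<open>i\<close> has input vector \<open>a i\<close> and output vector \<open>b i\<close>.
  The order on \<open>real ^ 'n\<close> is the entrywise one.  The matrices \<open>X\<close>, \<open>Y\<close> of the tested unit \<open>k\<close>
  have one row for each \<open>i \<in> {1..N} - {k}\<close> (none if \<open>N = 1\<close>), so inequalities between
  \<open>Y u\<close> and \<open>X v\<close> are written row by row.
\<close>

definition dea_feasible ::
  "nat \<Rightarrow> (nat \<Rightarrow> real ^ 'm) \<Rightarrow> (nat \<Rightarrow> real ^ 'n) \<Rightarrow> nat \<Rightarrow> (real ^ 'n) \<Rightarrow> (real ^ 'm) \<Rightarrow> bool"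
  where
  "dea_feasible N a b k u v \<longleftrightarrow>
     a k \<bullet> v \<le> 1 \<and>
     (\<forall>i \<in> {1..N} - {k}. b i \<bullet> u - a i \<bullet> v \<le> 0) \<and>
     0 \<le> u \<and> 0 \<le> v"

text \<open>The feasible set contains \<open>(0, 0)\<close>; the supremum is \<open>\<infinity>\<close> iff the program is unbounded.\<close>

definition dea_ranking ::
  "nat \<Rightarrow> (nat \<Rightarrow> real ^ 'm) \<Rightarrow> (nat \<Rightarrow> real ^ 'n) \<Rightarrow> nat \<Rightarrow> ereal"
  where
  "dea_ranking N a b k = Sup {ereal (b k \<bullet> u) |u v. dea_feasible N a b k u v}"

definition robust_feasible ::
  "nat \<Rightarrow> (nat \<Rightarrow> real ^ 'm) \<Rightarrow> (nat \<Rightarrow> real ^ 'n) \<Rightarrow> nat \<Rightarrow>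
     real \<Rightarrow> (real ^ 'n) \<Rightarrow> (real ^ 'm) \<Rightarrow> bool"
  where
  "robust_feasible N a b k \<delta> u v \<longleftrightarrow>
     (1 - \<delta>) * (b k \<bullet> u) \<ge> 1 \<and>
     (1 + \<delta>) * (a k \<bullet> v) \<le> 1 \<and>
     (\<forall>i \<in> {1..N} - {k}. (1 + \<delta>) * (b i \<bullet> u) - (1 - \<delta>) * (a i \<bullet> v) \<le> 0) \<and>
     0 \<le> u \<and> 0 \<le> v"

definition robust_levels ::
  "nat \<Rightarrow> (nat \<Rightarrow> real ^ 'm) \<Rightarrow> (nat \<Rightarrow> real ^ 'n) \<Rightarrow> nat \<Rightarrow> real set"
  where
  "robust_levels N a b k = {\<delta>. \<exists>u v. robust_feasible N a b k \<delta> u v}"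

text \<open>
  For nonnegative data the feasible values of \<open>\<delta>\<close> are bounded above by 1.  The program is
  infeasible exactly when the tested unit has no output at all, and otherwise \<open>\<delta> = -1\<close> is feasible.
\<close>

lemma robust_levels_less_1:
  assumes "0 \<le> b k" and "\<delta> \<in> robust_levels N a b k"
  shows "\<delta> < 1"
proof -
  obtain u where u: "(1 - \<delta>) * (b k \<bullet> u) \<ge> 1" "0 \<le> u"
    using assms(2) by (auto simp: robust_levels_def robust_feasible_def)
  have "0 \<le> b k \<bullet> u"
    using assms(1) u(2) by (auto simp: inner_vec_def less_eq_vec_def intro!: sum_nonneg)
  then show ?thesis
    using u(1) mult_nonpos_nonneg[of "1 - \<delta>" "b k \<bullet> u"] by linarith
qed

lemma robust_levels_eq_empty_iff:
  assumes "0 \<le> b k"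
  shows "robust_levels N a b k = {} \<longleftrightarrow> b k = 0"
    and "robust_levels N a b k \<noteq> {} \<Longrightarrow> - 1 \<in> robust_levels N a b k"
proof -
  have minus1: "- 1 \<in> robust_levels N a b k" if "b k \<noteq> 0"
  proof -
    define u where "u = (1 / (2 * (b k \<bullet> b k))) *\<^sub>R b k"
    have "b k \<bullet> u = 1 / 2" "0 \<le> u"
      using that assms by (auto simp: u_def less_eq_vec_def)
    then have "robust_feasible N a b k (- 1) u 0"
      by (simp add: robust_feasible_def)
    then show ?thesis
      unfolding robust_levels_def by blast
  qed
  show 1: "robust_levels N a b k = {} \<longleftrightarrow> b k = 0"
  proof
    show "b k = 0" if "robust_levels N a b k = {}"
      using minus1 that by blast
    show "robust_levels N a b k = {}" if "b k = 0"
      using that by (simp add: robust_levels_def robust_feasible_def)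
  qed
  show "- 1 \<in> robust_levels N a b k" if "robust_levels N a b k \<noteq> {}"
    using minus1 1 that by blast
qed

text \<open>
  An infeasible program (a unit without output) is given the value \<open>\<delta> = -1\<close>, the smallest optimal
  value that a feasible one can have.  This is a convention: the extended-real supremum
  \<open>-\<infinity>\<close> would rank a unit without output strictly below a unit that has an output but whose
  classical ranking is 0 as well (possible when another unit has zero input), e.g. units 1 and 3 for
  one input \<open>a = (1, 0, 1)\<close> and one output \<open>b = (0, 1, 1)\<close>.
\<close>

definition robust_ranking ::
  "nat \<Rightarrow> (nat \<Rightarrow> real ^ 'm) \<Rightarrow> (nat \<Rightarrow> real ^ 'n) \<Rightarrow> nat \<Rightarrow> real"
  where
  "robust_ranking N a b k =
     1 + 2 * (if robust_levels N a b k = {} then - 1 else Sup (robust_levels N a b k))"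

end

theory Submission
  imports Defs
begin

text \<open>
  For \<open>-1 < \<delta> < 1\<close> the robust program becomes the classical one after rescaling its variables.
  The substitution \<open>v' = (1 + \<delta>) v\<close> turns the normalisation into \<open>x\<^sub>0\<^sup>T v' \<le> 1\<close>,
  and then \<open>u' = ((1 + \<delta>)\<^sup>2 / (1 - \<delta>)) u\<close> turns the remaining rows into \<open>Y u' \<le> X v'\<close>.  The
  constraint \<open>(1 - \<delta>) y\<^sub>0\<^sup>T u \<ge> 1\<close> becomes \<open>y\<^sub>0\<^sup>T u' \<ge> ((1 + \<delta>) / (1 - \<delta>))\<^sup>2\<close>.  So a level
  \<open>\<delta>\<close> is feasible iff the classical program reaches the value
  \<open>((1 + \<delta>) / (1 - \<delta>))\<^sup>2\<close> (lemma \<open>robust_levels_iff_dea_value\<close>).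

  The map \<open>\<delta> \<mapsto> ((1 + \<delta>) / (1 - \<delta>))\<^sup>2\<close> is an increasing bijection from \<open>{-1<..<1}\<close> onto
  \<open>{0<..}\<close>.  It therefore carries the cut that the robust optimum makes in \<open>{-1<..<1}\<close> to the cut
  that the classical optimum makes in \<open>{0<..}\<close> (lemma \<open>less_robust_optimum_iff\<close>).
  The two optima lie in \<open>{-1..1}\<close> and in \<open>{0..\<infinity>}\<close> and are determined by these cuts, so the two
  rankings order the units in the same way.  Comparing cuts instead of optimal values treats
  unbounded classical programs, suprema that are not attained and units without output uniformly.
\<close>

definition dea_value_of_level :: "real \<Rightarrow> real" where
  "dea_value_of_level \<delta> = ((1 + \<delta>) / (1 - \<delta>))\<^sup>2"

definition level_of_dea_value :: "real \<Rightarrow> real" where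
  "level_of_dea_value w = (sqrt w - 1) / (sqrt w + 1)"

lemma dea_value_of_level_strict_mono:
  assumes "- 1 < \<delta>" "\<delta> < \<delta>'" "\<delta>' < 1"
  shows "dea_value_of_level \<delta> < dea_value_of_level \<delta>'"
proof -
  have "(1 + \<delta>) / (1 - \<delta>) < (1 + \<delta>') / (1 - \<delta>')"
    using assms by (intro frac_less) auto
  then show ?thesis
    unfolding dea_value_of_level_def using assms by (intro power_strict_mono) auto
qed

lemma level_of_dea_value_bounds:
  assumes "0 < w"
  shows "- 1 < level_of_dea_value w" "level_of_dea_value w < 1"
  using assms by (auto simp: level_of_dea_value_def field_simps add_pos_pos)

lemma dea_value_of_level_of_dea_value:
  assumes "0 < w"
  shows "dea_value_of_level (level_of_dea_value w) = w"
proof -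
  have pos: "0 < sqrt w + 1"
    using assms by (simp add: add_pos_pos)
  have "1 + level_of_dea_value w = 2 * sqrt w / (sqrt w + 1)"
    and "1 - level_of_dea_value w = 2 / (sqrt w + 1)"
    using pos by (simp_all add: level_of_dea_value_def field_simps)
  then have "(1 + level_of_dea_value w) / (1 - level_of_dea_value w) = sqrt w"
    using pos by simp
  then show ?thesis
    using assms by (simp add: dea_value_of_level_def)
qed

lemma scaleR_vec_nonneg_iff:
  fixes x :: "real ^ 'd"
  assumes "0 < c"
  shows "0 \<le> c *\<^sub>R x \<longleftrightarrow> 0 \<le> x"
  using assms by (simp add: less_eq_vec_def zero_le_mult_iff)

text \<open>
  The rescaling \<open>u \<mapsto> ((1 + \<delta>)\<^sup>2 / (1 - \<delta>)) u\<close>, \<open>v \<mapsto> (1 + \<delta>) v\<close> is invertible and preserves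
  nonnegativity because both factors are positive; at \<open>\<delta> = -1\<close> it would degenerate.
\<close>

lemma robust_levels_iff_dea_value:
  assumes \<delta>: "- 1 < \<delta>" "\<delta> < 1"
  shows "\<delta> \<in> robust_levels N a b k \<longleftrightarrow>
    (\<exists>u v. dea_feasible N a b k u v \<and> dea_value_of_level \<delta> \<le> b k \<bullet> u)"
proof -
  define p q where "p = 1 + \<delta>" and "q = 1 - \<delta>"
  have pq: "0 < p" "0 < q"
    using \<delta> by (auto simp: p_def q_def)
  have scaled: "robust_feasible N a b k \<delta> u v \<longleftrightarrow>
      dea_feasible N a b k ((p\<^sup>2 / q) *\<^sub>R u) (p *\<^sub>R v) \<and>
      dea_value_of_level \<delta> \<le> b k \<bullet> ((p\<^sup>2 / q) *\<^sub>R u)" for u v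
  proof -
    have objective: "(1 - \<delta>) * (b k \<bullet> u) \<ge> 1 \<longleftrightarrow>
        dea_value_of_level \<delta> \<le> b k \<bullet> ((p\<^sup>2 / q) *\<^sub>R u)"
    proof -
      have "b k \<bullet> ((p\<^sup>2 / q) *\<^sub>R u) = (p / q)\<^sup>2 * (q * (b k \<bullet> u))"
        using pq by (simp add: power2_eq_square)
      moreover have "0 < (p / q)\<^sup>2"
        using pq by simp
      ultimately show ?thesis
        unfolding dea_value_of_level_def p_def[symmetric] q_def[symmetric]
        by (metis mult_le_cancel_left_pos mult.right_neutral)
    qed
    have rows: "(1 + \<delta>) * (b i \<bullet> u) - (1 - \<delta>) * (a i \<bullet> v) \<le> 0 \<longleftrightarrow>
        b i \<bullet> ((p\<^sup>2 / q) *\<^sub>R u) - a i \<bullet> (p *\<^sub>R v) \<le> 0" for i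
    proof -
      have "b i \<bullet> ((p\<^sup>2 / q) *\<^sub>R u) - a i \<bullet> (p *\<^sub>R v) =
          p / q * (p * (b i \<bullet> u) - q * (a i \<bullet> v))"
        using pq by (simp add: power2_eq_square right_diff_distrib)
      moreover have "0 < p / q"
        using pq by simp
      ultimately show ?thesis
        unfolding p_def[symmetric] q_def[symmetric]
        by (metis mult_le_cancel_left_pos mult_zero_right)
    qed
    have nonneg: "0 \<le> (p\<^sup>2 / q) *\<^sub>R u \<longleftrightarrow> 0 \<le> u" "0 \<le> p *\<^sub>R v \<longleftrightarrow> 0 \<le> v"
      using pq by (simp_all add: scaleR_vec_nonneg_iff)
    have input: "(1 + \<delta>) * (a k \<bullet> v) = a k \<bullet> (p *\<^sub>R v)"
      by (simp add: p_def)
    show ?thesis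
      unfolding robust_feasible_def dea_feasible_def objective rows input nonneg by blast
  qed
  show ?thesis
  proof
    assume "\<delta> \<in> robust_levels N a b k"
    then show "\<exists>u v. dea_feasible N a b k u v \<and> dea_value_of_level \<delta> \<le> b k \<bullet> u"
      unfolding robust_levels_def using scaled by blast
  next
    assume "\<exists>u v. dea_feasible N a b k u v \<and> dea_value_of_level \<delta> \<le> b k \<bullet> u"
    then obtain u v where "dea_feasible N a b k u v" "dea_value_of_level \<delta> \<le> b k \<bullet> u"
      by blast
    moreover have "(p\<^sup>2 / q) *\<^sub>R (q / p\<^sup>2) *\<^sub>R u = u" "p *\<^sub>R (1 / p) *\<^sub>R v = v"
      using pq by simp_all
    ultimately have "robust_feasible N a b k \<delta> ((q / p\<^sup>2) *\<^sub>R u) ((1 / p) *\<^sub>R v)"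
      by (simp only: scaled)
    then show "\<delta> \<in> robust_levels N a b k"
      unfolding robust_levels_def by blast
  qed
qed

definition robust_optimum ::
  "nat \<Rightarrow> (nat \<Rightarrow> real ^ 'm) \<Rightarrow> (nat \<Rightarrow> real ^ 'n) \<Rightarrow> nat \<Rightarrow> real" where
  "robust_optimum N a b k =
     (if robust_levels N a b k = {} then - 1 else Sup (robust_levels N a b k))"

lemma bdd_above_robust_levels:
  assumes "0 \<le> b k"
  shows "bdd_above (robust_levels N a b k)"
  using robust_levels_less_1[of b k, OF assms] by (intro bdd_aboveI[of _ 1] less_imp_le)

lemma robust_optimum_bounds:
  assumes "0 \<le> b k"
  shows "- 1 \<le> robust_optimum N a b k" "robust_optimum N a b k \<le> 1"
proof -
  have "- 1 \<le> Sup (robust_levels N a b k)" if "robust_levels N a b k \<noteq> {}"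
    using robust_levels_eq_empty_iff(2)[OF assms that] bdd_above_robust_levels[of b k, OF assms]
    by (rule cSup_upper)
  moreover have "Sup (robust_levels N a b k) \<le> 1" if "robust_levels N a b k \<noteq> {}"
    using that robust_levels_less_1[of b k, OF assms] by (intro cSup_least less_imp_le)
  ultimately show "- 1 \<le> robust_optimum N a b k" "robust_optimum N a b k \<le> 1"
    by (auto simp: robust_optimum_def)
qed

lemma dea_ranking_nonneg: "0 \<le> dea_ranking N a b k"
proof -
  have "dea_feasible N a b k 0 0"
    by (simp add: dea_feasible_def)
  then have "ereal (b k \<bullet> 0) \<in> {ereal (b k \<bullet> u) |u v. dea_feasible N a b k u v}"
    by blast
  then have "ereal (b k \<bullet> 0) \<le> dea_ranking N a b k"
    unfolding dea_ranking_def by (rule Sup_upper)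
  then show ?thesis
    by (simp add: zero_ereal_def)
qed

lemma less_dea_ranking_iff:
  "ereal w < dea_ranking N a b k \<longleftrightarrow> (\<exists>u v. dea_feasible N a b k u v \<and> w < b k \<bullet> u)"
  unfolding dea_ranking_def less_Sup_iff by force

text \<open>
  Strict inequalities make the correspondence hold whether or not the suprema are attained: lying
  strictly below a supremum means lying strictly below a feasible value.
\<close>

lemma less_robust_optimum_iff:
  assumes b: "0 \<le> b k" and \<delta>: "- 1 < \<delta>" "\<delta> < 1"
  shows "\<delta> < robust_optimum N a b k \<longleftrightarrow> ereal (dea_value_of_level \<delta>) < dea_ranking N a b k"
proof
  assume less: "\<delta> < robust_optimum N a b k"
  \<comment> \<open>The default value \<open>-1\<close> of an infeasible program is below \<open>\<delta>\<close>, so it does not occur here.\<close>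
  with \<delta> have "robust_levels N a b k \<noteq> {}" "\<delta> < Sup (robust_levels N a b k)"
    by (auto simp: robust_optimum_def split: if_splits)
  then obtain \<delta>' where \<delta>': "\<delta>' \<in> robust_levels N a b k" "\<delta> < \<delta>'"
    by (meson less_cSupE)
  then have "\<delta>' < 1"
    using robust_levels_less_1 b by blast
  then obtain u v where uv: "dea_feasible N a b k u v" "dea_value_of_level \<delta>' \<le> b k \<bullet> u"
    using robust_levels_iff_dea_value[of \<delta>'] \<delta>' \<delta> by force
  have "dea_value_of_level \<delta> < b k \<bullet> u"
    using dea_value_of_level_strict_mono[OF \<delta>(1) \<delta>'(2) \<open>\<delta>' < 1\<close>] uv(2) by linarith
  then show "ereal (dea_value_of_level \<delta>) < dea_ranking N a b k"
    using uv(1) less_dea_ranking_iff by blast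
next
  assume "ereal (dea_value_of_level \<delta>) < dea_ranking N a b k"
  then obtain u v where uv: "dea_feasible N a b k u v" "dea_value_of_level \<delta> < b k \<bullet> u"
    using less_dea_ranking_iff by blast
  define \<delta>' where "\<delta>' = level_of_dea_value (b k \<bullet> u)"
  have "0 < b k \<bullet> u"
    using uv(2) unfolding dea_value_of_level_def by (rule le_less_trans[OF zero_le_power2])
  then have \<delta>': "- 1 < \<delta>'" "\<delta>' < 1" "dea_value_of_level \<delta>' = b k \<bullet> u"
    by (simp_all add: \<delta>'_def level_of_dea_value_bounds dea_value_of_level_of_dea_value)
  then have level: "\<delta>' \<in> robust_levels N a b k"
    using robust_levels_iff_dea_value uv(1) by (metis order_refl)
  have "\<delta> < \<delta>'"
    using dea_value_of_level_strict_mono[of \<delta>' \<delta>] \<delta>' \<delta> uv(2) by (cases "\<delta> = \<delta>'") force+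
  also have "\<delta>' \<le> robust_optimum N a b k"
    using level cSup_upper[OF level] bdd_above_robust_levels[of b k N a] b
    by (auto simp: robust_optimum_def)
  finally show "\<delta> < robust_optimum N a b k" .
qed

text \<open>
  A strict inequality between two optima is witnessed by a point in between.  The bounds on the
  optima place it in \<open>{-1<..<1}\<close> or in \<open>{0<..}\<close>, where cuts can be transferred.
\<close>

lemma robust_optimum_less_iff:
  assumes bk: "0 \<le> b k" and bl: "0 \<le> b l"
  shows "robust_optimum N a b l < robust_optimum N a b k \<longleftrightarrow>
    dea_ranking N a b l < dea_ranking N a b k"
proof
  assume "robust_optimum N a b l < robust_optimum N a b k"
  then obtain \<delta> where \<delta>: "robust_optimum N a b l < \<delta>" "\<delta> < robust_optimum N a b k"
    using dense by blast
  then have "- 1 < \<delta>" "\<delta> < 1"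
    using robust_optimum_bounds(1)[of b l N a] robust_optimum_bounds(2)[of b k N a] bk bl
    by linarith+
  then have "dea_ranking N a b l \<le> ereal (dea_value_of_level \<delta>)"
      and "ereal (dea_value_of_level \<delta>) < dea_ranking N a b k"
    using less_robust_optimum_iff[of b l \<delta> N a] less_robust_optimum_iff[of b k \<delta> N a] bk bl \<delta>
    by (auto simp: not_less)
  then show "dea_ranking N a b l < dea_ranking N a b k"
    by (rule le_less_trans)
next
  assume "dea_ranking N a b l < dea_ranking N a b k"
  then obtain w where w: "dea_ranking N a b l < ereal w" "ereal w < dea_ranking N a b k"
    using ereal_dense2 by blast
  have "0 < ereal w"
    using dea_ranking_nonneg w(1) by (rule le_less_trans)
  then have "0 < w"
    by simp
  then have "robust_optimum N a b l \<le> level_of_dea_value w"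
      and "level_of_dea_value w < robust_optimum N a b k"
    using less_robust_optimum_iff[of b l "level_of_dea_value w" N a]
      less_robust_optimum_iff[of b k "level_of_dea_value w" N a] bk bl w
    by (simp_all add: level_of_dea_value_bounds dea_value_of_level_of_dea_value not_less
        order_less_imp_le leD)
  then show "robust_optimum N a b l < robust_optimum N a b k"
    by linarith
qed

theorem proposition3:
  fixes N :: nat
    and a :: "nat \<Rightarrow> real ^ 'm"
    and b :: "nat \<Rightarrow> real ^ 'n"
  assumes "N \<ge> 1"
    and "\<And>i. i \<in> {1..N} \<Longrightarrow> 0 \<le> a i"
    and "\<And>i. i \<in> {1..N} \<Longrightarrow> 0 \<le> b i"
  shows "\<forall>k \<in> {1..N}. \<forall>l \<in> {1..N}.
    robust_ranking N a b k \<le> robust_ranking N a b l \<longleftrightarrow>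
    dea_ranking N a b k \<le> dea_ranking N a b l"
proof (intro ballI)
  fix k l assume "k \<in> {1..N}" "l \<in> {1..N}"
  then have "0 \<le> b k" "0 \<le> b l"
    using assms(3) by blast+
  then have "robust_optimum N a b k \<le> robust_optimum N a b l \<longleftrightarrow>
      dea_ranking N a b k \<le> dea_ranking N a b l"
    using robust_optimum_less_iff[of b k l N a] by (simp only: linorder_not_less[symmetric])
  moreover have "robust_ranking N a b i = 1 + 2 * robust_optimum N a b i" for i
    by (simp add: robust_ranking_def robust_optimum_def)
  ultimately show "robust_ranking N a b k \<le> robust_ranking N a b l \<longleftrightarrow>
      dea_ranking N a b k \<le> dea_ranking N a b l"
    by simp
qed

end
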